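(* Let $\Bbbk$ be a field of characteristic zero, let $\mathsf{X}=\Bbbk\mathsf{X}_0$ be a linearized coalgebra in species, viewed as an $\mathsf{E}$-bicomodule, and let $\Delta_1:\mathsf{X}\to\mathsf{E}^{\cdot2}$ be a normalized $2$-cocycle in $C^*(\mathsf{X},\mathsf{E})$. Then there exists a weak deformation of $\mathsf{X}$ corresponding to $\Delta_1$, i.e. a weak deformation whose coefficient of $t$ is $\Delta_1$.
   Context: A (linear) species is a functor from finite sets and bijections to $\Bbbk$-modules; the Cauchy product is $(\mathsf{X}\cdot\mathsf{Y})[I]=\bigoplus_{(S,T)}\mathsf{X}[S]\otimes\mathsf{Y}[T]$ over decompositions (ordered pairs of disjoint, possibly empty, sets with union $I$). $\mathsf{E}[I]=\Bbbk e_I$ is the exponential species. A linearized coalgebra $\mathsf{X}=\Bbbk\mathsf{X}_0$ is one arising from a set species $\mathsf{X}_0$ with maps $\mathsf{X}_0[I]\to\mathsf{X}_0[S]\times\mathsf{X}_0[T]$, $z\mapsto(z\backslash\!\backslash S,z/\!/T)$, natural, coassociative and counital (with counit $\varepsilon$ sending every element of $\mathsf{X}_0[\varnothing]$ to $1$), so that $\Delta(S,T)(z)=z\backslash\!\backslash S\otimes z/\!/T$ for $z\in\mathsf{X}_0[I]$. A map $\alpha:\mathsf{X}\to\mathsf{E}^{\cdot 2}$ of species is given by natural coefficients $\alpha(S,T)(z)\in\Bbbk$, linear in $z\in\mathsf{X}[I]$, for decompositions $(S,T)$ of $I$. It is a $2$-cocycle if for all decompositions $(R,S,T)$ of $I$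 and $z\in\mathsf{X}_0[I]$ $$\alpha(R\cup S,T)(z)+\alpha(R,S)(z\backslash\!\backslash(R\cup S))=\alpha(R,S\cup T)(z)+\alpha(S,T)(z/\!/(S\cup T)),$$ and normalized if $\alpha(S,T)(z)=0$ whenever $S$ or $T$ is empty. Let $K=\Bbbk[[t]]$ and let $\mathsf{X}[[t]]$ be the species over $K$ obtained by extending scalars pointwise. A weak deformation of $\mathsf{X}$ is a $K$-linear (coassociative, counital with respect to $\varepsilon$) coalgebra structure $\Delta_t$ on $\mathsf{X}[[t]]$ determined on generators $z\in\mathsf{X}_0[I]$ by $$\Delta_t(S,T)(z)=\Bigl(\sum_{i\ge0}\Delta_i(S,T)(z)\,t^i\Bigr)\,z\backslash\!\backslash S\otimes z/\!/T$$ for some maps of species $\Delta_i:\mathsf{X}\to\mathsf{E}^{\cdot2}$ with $\Delta_0(S,T)(z)=1$ for $z\in\mathsf{X}_0[I]$. *)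

theory Defs
  imports
    "HOL-Library.Poly_Mapping"
    "HOL-Library.Infinite_Typeclass"
    "HOL-Computational_Algebra.Formal_Power_Series"
begin

section \<open>Free modules\<close>

text \<open>
  The free module over a commutative ring on a set \<open>A\<close> is the set of finitely supported functions
  whose support lies in \<open>A\<close>. The tensor product of the free modules on \<open>A\<close> and \<open>B\<close> is modelled by
  the free module on \<open>A \<times> B\<close>, with \<open>tensor\<close> as its universal bilinear map.
\<close>

definition free_on :: "'x set \<Rightarrow> ('x \<Rightarrow>\<^sub>0 'a::comm_ring_1) set" where
  "free_on A = {v. Poly_Mapping.keys v \<subseteq> A}"

definition gen :: "'x \<Rightarrow> ('x \<Rightarrow>\<^sub>0 'a::comm_ring_1)" where
  "gen x = Poly_Mapping.single x 1"

definition scale :: "'a::comm_ring_1 \<Rightarrow> ('x \<Rightarrow>\<^sub>0 'a) \<Rightarrow> ('x \<Rightarrow>\<^sub>0 'a)" where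
  "scale c v = Poly_Mapping.map ((*) c) v"

definition lin_ext :: "('x \<Rightarrow> ('y \<Rightarrow>\<^sub>0 'a)) \<Rightarrow> ('x \<Rightarrow>\<^sub>0 'a::comm_ring_1) \<Rightarrow> ('y \<Rightarrow>\<^sub>0 'a)" where
  "lin_ext f v = (\<Sum>x\<in>Poly_Mapping.keys v. scale (Poly_Mapping.lookup v x) (f x))"

definition linear_on ::
  "('a \<Rightarrow> 'w \<Rightarrow> 'w) \<Rightarrow> ('x \<Rightarrow>\<^sub>0 'a::comm_ring_1) set \<Rightarrow> (('x \<Rightarrow>\<^sub>0 'a) \<Rightarrow> 'w::ab_group_add) \<Rightarrow> bool" where
  "linear_on sc V f \<longleftrightarrow>
     (\<forall>u\<in>V. \<forall>v\<in>V. f (u + v) = f u + f v) \<and> (\<forall>c. \<forall>v\<in>V. f (scale c v) = sc c (f v))"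

definition tensor ::
  "('x \<Rightarrow>\<^sub>0 'a) \<Rightarrow> ('y \<Rightarrow>\<^sub>0 'a) \<Rightarrow> ('x \<times> 'y \<Rightarrow>\<^sub>0 'a::comm_ring_1)" where
  "tensor u v = lin_ext (\<lambda>x. lin_ext (\<lambda>y. gen (x, y)) v) u"

text \<open>The tensor product of two linear maps is determined by its values on \<open>x \<otimes> y\<close>.\<close>

definition tensor_map ::
  "(('x \<Rightarrow>\<^sub>0 'a) \<Rightarrow> ('u \<Rightarrow>\<^sub>0 'a)) \<Rightarrow> (('y \<Rightarrow>\<^sub>0 'a) \<Rightarrow> ('v \<Rightarrow>\<^sub>0 'a)) \<Rightarrow>
   ('x \<times> 'y \<Rightarrow>\<^sub>0 'a::comm_ring_1) \<Rightarrow> ('u \<times> 'v \<Rightarrow>\<^sub>0 'a)" where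
  "tensor_map f g = lin_ext (\<lambda>(x, y). tensor (f (gen x)) (g (gen y)))"

definition reassoc :: "(('x \<times> 'y) \<times> 'z \<Rightarrow>\<^sub>0 'a) \<Rightarrow> ('x \<times> ('y \<times> 'z) \<Rightarrow>\<^sub>0 'a::comm_ring_1)" where
  "reassoc = lin_ext (\<lambda>((x, y), z). gen (x, (y, z)))"

lemma lookup_scale [simp]: "Poly_Mapping.lookup (scale c v) x = c * Poly_Mapping.lookup v x"
  by (simp add: scale_def Poly_Mapping.map.rep_eq when_def)

lemma module_scale: "module (scale :: 'a::comm_ring_1 \<Rightarrow> ('x \<Rightarrow>\<^sub>0 'a) \<Rightarrow> ('x \<Rightarrow>\<^sub>0 'a))"
  by (unfold_locales; rule poly_mapping_eqI) (simp_all add: lookup_add algebra_simps)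

lemma lin_ext_gen [simp]: "lin_ext f (gen x) = f x"
  by (rule poly_mapping_eqI) (simp add: lin_ext_def gen_def)

lemma tensor_gen [simp]: "tensor (gen x) (gen y) = gen (x, y)"
  by (simp add: tensor_def)


section \<open>Set species and linearized coalgebras\<close>

text \<open>
  Finite sets are represented by the finite subsets of an arbitrary infinite type \<open>'l\<close>; with
  bijections as morphisms these form a category equivalent to that of all finite sets and bijections.
  For \<open>\<sigma>\<close> injective on \<open>I\<close>, \<open>tr I \<sigma>\<close> is the map induced by the bijection \<open>I \<rightarrow> \<sigma> ` I\<close>; since
  \<open>\<sigma>\<close> is a total function, one has to require that only its restriction to \<open>I\<close> matters.
\<close>

locale set_species =
  fixes X0 :: "'l::infinite set \<Rightarrow> 'x set"
    and tr :: "'l set \<Rightarrow> ('l \<Rightarrow> 'l) \<Rightarrow> 'x \<Rightarrow> 'x"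
  assumes tr_closed:
      "\<And>I \<sigma> z. finite I \<Longrightarrow> inj_on \<sigma> I \<Longrightarrow> z \<in> X0 I \<Longrightarrow> tr I \<sigma> z \<in> X0 (\<sigma> ` I)"
    and tr_cong:
      "\<And>I \<sigma> \<tau> z. finite I \<Longrightarrow> inj_on \<sigma> I \<Longrightarrow> (\<And>i. i \<in> I \<Longrightarrow> \<sigma> i = \<tau> i) \<Longrightarrow> z \<in> X0 I
        \<Longrightarrow> tr I \<sigma> z = tr I \<tau> z"
    and tr_id:
      "\<And>I z. finite I \<Longrightarrow> z \<in> X0 I \<Longrightarrow> tr I id z = z"
    and tr_comp:
      "\<And>I \<sigma> \<tau> z. finite I \<Longrightarrow> inj_on \<sigma> I \<Longrightarrow> inj_on \<tau> (\<sigma> ` I) \<Longrightarrow> z \<in> X0 I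
        \<Longrightarrow> tr I (\<tau> \<circ> \<sigma>) z = tr (\<sigma> ` I) \<tau> (tr I \<sigma> z)"

text \<open>
  A decomposition \<open>(S, T)\<close> determines the set \<open>I = S \<union> T\<close> it decomposes, so that structure maps and
  cochains are indexed by \<open>S\<close> and \<open>T\<close> alone.
\<close>

definition decomp :: "'l set \<Rightarrow> 'l set \<Rightarrow> bool" where
  "decomp S T \<longleftrightarrow> finite S \<and> finite T \<and> S \<inter> T = {}"

definition decomp3 :: "'l set \<Rightarrow> 'l set \<Rightarrow> 'l set \<Rightarrow> bool" where
  "decomp3 R S T \<longleftrightarrow> decomp R S \<and> decomp R T \<and> decomp S T"

text \<open>
  For \<open>z \<in> X0 (S \<union> T)\<close>, \<open>lft S T z\<close> is \<open>z\<setminus>\<setminus>S\<close> and \<open>rgt S T z\<close> is \<open>z//T\<close>. Both arguments are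
  needed: the sets \<open>X0 I\<close> need not be disjoint for different \<open>I\<close>.
\<close>

locale linearized_coalgebra = set_species X0 tr
  for X0 :: "'l::infinite set \<Rightarrow> 'x set" and tr :: "'l set \<Rightarrow> ('l \<Rightarrow> 'l) \<Rightarrow> 'x \<Rightarrow> 'x" +
  fixes lft rgt :: "'l set \<Rightarrow> 'l set \<Rightarrow> 'x \<Rightarrow> 'x"
  assumes lft_closed: "\<And>S T z. decomp S T \<Longrightarrow> z \<in> X0 (S \<union> T) \<Longrightarrow> lft S T z \<in> X0 S"
    and rgt_closed: "\<And>S T z. decomp S T \<Longrightarrow> z \<in> X0 (S \<union> T) \<Longrightarrow> rgt S T z \<in> X0 T"
    and lft_natural:
      "\<And>S T \<sigma> z. decomp S T \<Longrightarrow> inj_on \<sigma> (S \<union> T) \<Longrightarrow> z \<in> X0 (S \<union> T)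
        \<Longrightarrow> lft (\<sigma> ` S) (\<sigma> ` T) (tr (S \<union> T) \<sigma> z) = tr S \<sigma> (lft S T z)"
    and rgt_natural:
      "\<And>S T \<sigma> z. decomp S T \<Longrightarrow> inj_on \<sigma> (S \<union> T) \<Longrightarrow> z \<in> X0 (S \<union> T)
        \<Longrightarrow> rgt (\<sigma> ` S) (\<sigma> ` T) (tr (S \<union> T) \<sigma> z) = tr T \<sigma> (rgt S T z)"
    and coassoc_left:
      "\<And>R S T z. decomp3 R S T \<Longrightarrow> z \<in> X0 (R \<union> S \<union> T)
        \<Longrightarrow> lft R S (lft (R \<union> S) T z) = lft R (S \<union> T) z"
    and coassoc_middle:
      "\<And>R S T z. decomp3 R S T \<Longrightarrow> z \<in> X0 (R \<union> S \<union> T)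
        \<Longrightarrow> rgt R S (lft (R \<union> S) T z) = lft S T (rgt R (S \<union> T) z)"
    and coassoc_right:
      "\<And>R S T z. decomp3 R S T \<Longrightarrow> z \<in> X0 (R \<union> S \<union> T)
        \<Longrightarrow> rgt (R \<union> S) T z = rgt S T (rgt R (S \<union> T) z)"
    and counit_left: "\<And>I z. finite I \<Longrightarrow> z \<in> X0 I \<Longrightarrow> rgt {} I z = z"
    and counit_right: "\<And>I z. finite I \<Longrightarrow> z \<in> X0 I \<Longrightarrow> lft I {} z = z"


section \<open>Cochains with values in the exponential species\<close>

definition transport ::
  "('l set \<Rightarrow> ('l \<Rightarrow> 'l) \<Rightarrow> 'x \<Rightarrow> 'x) \<Rightarrow> 'l set \<Rightarrow> ('l \<Rightarrow> 'l) \<Rightarrow>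
   ('x \<Rightarrow>\<^sub>0 'a::comm_ring_1) \<Rightarrow> ('x \<Rightarrow>\<^sub>0 'a)" where
  "transport tr I \<sigma> = lin_ext (\<lambda>z. gen (tr I \<sigma> z))"

text \<open>
  A map of species from \<open>X\<close> to the Cauchy square of \<open>E\<close>, given by its coefficients: the component of
  \<open>v \<in> X[S \<union> T]\<close> in the summand \<open>E[S] \<otimes> E[T]\<close> is \<open>\<alpha> S T v\<close> times the basis element.
\<close>

definition species_map_E2 ::
  "('l set \<Rightarrow> 'x set) \<Rightarrow> ('l set \<Rightarrow> ('l \<Rightarrow> 'l) \<Rightarrow> 'x \<Rightarrow> 'x) \<Rightarrow>
   ('l set \<Rightarrow> 'l set \<Rightarrow> ('x \<Rightarrow>\<^sub>0 'k::comm_ring_1) \<Rightarrow> 'k) \<Rightarrow> bool" where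
  "species_map_E2 X0 tr \<alpha> \<longleftrightarrow>
     (\<forall>S T. decomp S T \<longrightarrow> linear_on (*) (free_on (X0 (S \<union> T))) (\<alpha> S T)) \<and>
     (\<forall>S T \<sigma>. decomp S T \<longrightarrow> inj_on \<sigma> (S \<union> T) \<longrightarrow>
        (\<forall>v\<in>free_on (X0 (S \<union> T)). \<alpha> (\<sigma> ` S) (\<sigma> ` T) (transport tr (S \<union> T) \<sigma> v) = \<alpha> S T v))"

text \<open>
  The \<open>E\<close>-bicomodule structure on \<open>X\<close> is induced by the coalgebra morphism \<open>X \<rightarrow> E\<close> sending each
  \<open>z \<in> X0 I\<close> to \<open>e\<^sub>I\<close>: its coactions are \<open>z \<mapsto> z\<setminus>\<setminus>S \<otimes> e\<^sub>T\<close> and \<open>z \<mapsto> e\<^sub>S \<otimes> z//T\<close>. The cocycle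
  condition below is the vanishing of the resulting coboundary, expressed in coefficients.
\<close>

definition two_cocycle ::
  "('l set \<Rightarrow> 'x set) \<Rightarrow> ('l set \<Rightarrow> ('l \<Rightarrow> 'l) \<Rightarrow> 'x \<Rightarrow> 'x) \<Rightarrow>
   ('l set \<Rightarrow> 'l set \<Rightarrow> 'x \<Rightarrow> 'x) \<Rightarrow> ('l set \<Rightarrow> 'l set \<Rightarrow> 'x \<Rightarrow> 'x) \<Rightarrow>
   ('l set \<Rightarrow> 'l set \<Rightarrow> ('x \<Rightarrow>\<^sub>0 'k::comm_ring_1) \<Rightarrow> 'k) \<Rightarrow> bool" where
  "two_cocycle X0 tr lft rgt \<alpha> \<longleftrightarrow>
     species_map_E2 X0 tr \<alpha> \<and>
     (\<forall>R S T. decomp3 R S T \<longrightarrow> (\<forall>z\<in>X0 (R \<union> S \<union> T).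
        \<alpha> (R \<union> S) T (gen z) + \<alpha> R S (gen (lft (R \<union> S) T z)) =
        \<alpha> R (S \<union> T) (gen z) + \<alpha> S T (gen (rgt R (S \<union> T) z))))"

definition normalized ::
  "('l set \<Rightarrow> 'x set) \<Rightarrow> ('l set \<Rightarrow> 'l set \<Rightarrow> ('x \<Rightarrow>\<^sub>0 'k::comm_ring_1) \<Rightarrow> 'k) \<Rightarrow> bool" where
  "normalized X0 \<alpha> \<longleftrightarrow>
     (\<forall>S T. decomp S T \<longrightarrow> S = {} \<or> T = {} \<longrightarrow> (\<forall>v\<in>free_on (X0 (S \<union> T)). \<alpha> S T v = 0))"


section \<open>Coalgebra structures and weak deformations\<close>

definition counit :: "('x \<Rightarrow>\<^sub>0 'a::comm_ring_1) \<Rightarrow> 'a" where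
  "counit v = (\<Sum>x\<in>Poly_Mapping.keys v. Poly_Mapping.lookup v x)"

text \<open>
  A coalgebra structure on the linearization of \<open>X0\<close> over an arbitrary commutative ring. In the
  counit axioms, the tensor product of the ground ring with a module is identified with that module.
\<close>

definition coalgebra ::
  "('l set \<Rightarrow> 'x set) \<Rightarrow> ('l set \<Rightarrow> ('l \<Rightarrow> 'l) \<Rightarrow> 'x \<Rightarrow> 'x) \<Rightarrow>
   ('l set \<Rightarrow> 'l set \<Rightarrow> ('x \<Rightarrow>\<^sub>0 'a::comm_ring_1) \<Rightarrow> ('x \<times> 'x \<Rightarrow>\<^sub>0 'a)) \<Rightarrow> bool" where
  "coalgebra X0 tr \<Delta> \<longleftrightarrow>
     (\<forall>S T. decomp S T \<longrightarrow>
        linear_on scale (free_on (X0 (S \<union> T))) (\<Delta> S T) \<and>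
        (\<forall>v\<in>free_on (X0 (S \<union> T)). \<Delta> S T v \<in> free_on (X0 S \<times> X0 T))) \<and>
     (\<forall>S T \<sigma>. decomp S T \<longrightarrow> inj_on \<sigma> (S \<union> T) \<longrightarrow>
        (\<forall>v\<in>free_on (X0 (S \<union> T)).
           \<Delta> (\<sigma> ` S) (\<sigma> ` T) (transport tr (S \<union> T) \<sigma> v) =
           tensor_map (transport tr S \<sigma>) (transport tr T \<sigma>) (\<Delta> S T v))) \<and>
     (\<forall>R S T. decomp3 R S T \<longrightarrow>
        (\<forall>v\<in>free_on (X0 (R \<union> S \<union> T)).
           reassoc (tensor_map (\<Delta> R S) id (\<Delta> (R \<union> S) T v)) =
           tensor_map id (\<Delta> S T) (\<Delta> R (S \<union> T) v))) \<and>
     (\<forall>I. finite I \<longrightarrow>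
        (\<forall>v\<in>free_on (X0 I).
           lin_ext (\<lambda>(x, y). scale (counit (gen x)) (gen y)) (\<Delta> {} I v) = v \<and>
           lin_ext (\<lambda>(x, y). scale (counit (gen y)) (gen x)) (\<Delta> I {} v) = v))"

text \<open>
  The extension of scalars of the free module on \<open>X0 I\<close> along \<open>k \<rightarrow> k[[t]]\<close> is the free
  \<open>k[[t]]\<close>-module on \<open>X0 I\<close>. It is not \<open>t\<close>-adically completed when \<open>X0 I\<close> is infinite.
\<close>

definition weak_deformation ::
  "('l set \<Rightarrow> 'x set) \<Rightarrow> ('l set \<Rightarrow> ('l \<Rightarrow> 'l) \<Rightarrow> 'x \<Rightarrow> 'x) \<Rightarrow>
   ('l set \<Rightarrow> 'l set \<Rightarrow> 'x \<Rightarrow> 'x) \<Rightarrow> ('l set \<Rightarrow> 'l set \<Rightarrow> 'x \<Rightarrow> 'x) \<Rightarrow>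
   ('l set \<Rightarrow> 'l set \<Rightarrow> ('x \<Rightarrow>\<^sub>0 'k::field_char_0 fps) \<Rightarrow> ('x \<times> 'x \<Rightarrow>\<^sub>0 'k fps)) \<Rightarrow>
   (nat \<Rightarrow> 'l set \<Rightarrow> 'l set \<Rightarrow> ('x \<Rightarrow>\<^sub>0 'k) \<Rightarrow> 'k) \<Rightarrow> bool" where
  "weak_deformation X0 tr lft rgt \<Delta>t D \<longleftrightarrow>
     coalgebra X0 tr \<Delta>t \<and>
     (\<forall>i. species_map_E2 X0 tr (D i)) \<and>
     (\<forall>S T. decomp S T \<longrightarrow> (\<forall>z\<in>X0 (S \<union> T). D 0 S T (gen z) = 1)) \<and>
     (\<forall>S T. decomp S T \<longrightarrow> (\<forall>z\<in>X0 (S \<union> T).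
        \<Delta>t S T (gen z) =
        scale (Abs_fps (\<lambda>i. D i S T (gen z))) (tensor (gen (lft S T z)) (gen (rgt S T z)))))"

end

theory Submission
  imports Defs
begin

text \<open>
  Multiply every generator \<open>z\<close> by the exponential series of the cocycle: put
  \<open>\<Delta>\<^sub>t(S, T)(z) = exp (t \<alpha>(S, T)(z)) z\<setminus>\<setminus>S \<otimes> z//T\<close> with \<open>\<alpha> = \<Delta>\<^sub>1\<close>, so that the coefficient of
  \<open>t\<^sup>i\<close> is \<open>\<alpha>(S, T)(z)\<^sup>i / i!\<close> on generators. The exponential turns sums into products, so the additive
  cocycle identity for \<open>\<alpha>\<close> becomes exactly the multiplicative identity that coassociativity of
  \<open>\<Delta>\<^sub>t\<close> demands of the scalar factors; the underlying tensors agree because \<open>X\<close> is coassociative.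
  Normalization makes the factor \<open>exp 0 = 1\<close> when \<open>S\<close> or \<open>T\<close> is empty, which gives the counit
  axioms, and naturality of \<open>\<alpha>\<close> gives naturality of each factor. The coefficient of \<open>t\<close> is \<open>\<alpha>\<close>
  on generators, hence everywhere by linearity. Characteristic zero is what makes the factorials
  invertible.

  Naturality, coassociativity and counitality are equalities of linear maps on free modules. The
  lemma \<open>linear_on_eqI\<close> reduces them to generators, where they are the statements above.
\<close>

section \<open>Linear maps out of free modules\<close>

definition lin_form :: "('x \<Rightarrow> 'a) \<Rightarrow> ('x \<Rightarrow>\<^sub>0 'a::comm_ring_1) \<Rightarrow> 'a" where
  "lin_form c v = (\<Sum>x\<in>Poly_Mapping.keys v. Poly_Mapping.lookup v x * c x)"

lemma lin_form_superset:
  assumes "finite K" "Poly_Mapping.keys v \<subseteq> K"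
  shows "lin_form c v = (\<Sum>x\<in>K. Poly_Mapping.lookup v x * c x)"
  unfolding lin_form_def using assms
  by (intro sum.mono_neutral_left) (auto simp: in_keys_iff)

lemma lin_form_gen [simp]: "lin_form c (gen x) = c x"
  by (simp add: lin_form_def gen_def)

lemma lin_form_add: "lin_form c (u + v) = lin_form c u + lin_form c v"
proof -
  let ?K = "Poly_Mapping.keys u \<union> Poly_Mapping.keys v"
  have "lin_form c w = (\<Sum>x\<in>?K. Poly_Mapping.lookup w x * c x)" if "w \<in> {u, v, u + v}" for w
    using that keys_add[of u v] by (intro lin_form_superset) auto
  then show ?thesis
    by (simp add: lookup_add distrib_right sum.distrib)
qed

lemma keys_scale_subset: "Poly_Mapping.keys (scale c v) \<subseteq> Poly_Mapping.keys v"
  by (auto simp: in_keys_iff)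

lemma lin_form_scale: "lin_form c (scale a v) = a * lin_form c v"
  using lin_form_superset[OF finite_keys keys_scale_subset]
  by (simp add: lin_form_def sum_distrib_left mult.assoc)

lemma linear_on_lin_form: "linear_on (*) V (lin_form c)"
  by (simp add: linear_on_def lin_form_add lin_form_scale)

text \<open>
  Coordinatewise, the linear extension of a map is a linear form; its linearity is inherited from
  there.
\<close>

lemma lookup_lin_ext:
  "Poly_Mapping.lookup (lin_ext f v) y = lin_form (\<lambda>x. Poly_Mapping.lookup (f x) y) v"
  by (simp add: lin_ext_def lin_form_def lookup_sum)

lemma lin_ext_add: "lin_ext f (u + v) = lin_ext f u + lin_ext f v"
  by (rule poly_mapping_eqI) (simp add: lookup_lin_ext lookup_add lin_form_add)

lemma lin_ext_scale [simp]: "lin_ext f (scale c v) = scale c (lin_ext f v)"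
  by (rule poly_mapping_eqI) (simp add: lookup_lin_ext lin_form_scale)

lemma linear_on_lin_ext: "linear_on scale V (lin_ext f)"
  by (simp add: linear_on_def lin_ext_add)

lemma linear_on_compose:
  assumes "linear_on scale V f" "linear_on sc W g" "\<And>v. v \<in> V \<Longrightarrow> f v \<in> W"
  shows "linear_on sc V (\<lambda>v. g (f v))"
  using assms by (simp add: linear_on_def)

lemma gen_in_free_on: "x \<in> A \<Longrightarrow> gen x \<in> free_on A"
  by (simp add: gen_def free_on_def)

lemma scale_in_free_on: "v \<in> free_on A \<Longrightarrow> scale c v \<in> free_on A"
  using keys_scale_subset[of c v] by (auto simp: free_on_def)

lemma sum_in_free_on: "(\<And>i. i \<in> J \<Longrightarrow> v i \<in> free_on A) \<Longrightarrow> (\<Sum>i\<in>J. v i) \<in> free_on A"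
  by (induction J rule: infinite_finite_induct)
    (use keys_add in \<open>fastforce simp: free_on_def\<close>)+

lemma lin_ext_in_free_on:
  assumes "v \<in> free_on A" "\<And>x. x \<in> A \<Longrightarrow> f x \<in> free_on B"
  shows "lin_ext f v \<in> free_on B"
  unfolding lin_ext_def using assms
  by (intro sum_in_free_on scale_in_free_on) (auto simp: free_on_def)

lemma free_on_expansion: "lin_ext gen v = v"
  by (rule poly_mapping_eqI)
    (auto simp: lookup_lin_ext lin_form_def gen_def lookup_single when_def in_keys_iff
      if_distrib[of "(*) _"] cong: if_cong)

lemma linear_on_add:
  "linear_on sc V f \<Longrightarrow> u \<in> V \<Longrightarrow> v \<in> V \<Longrightarrow> f (u + v) = f u + f v"
  by (simp add: linear_on_def)

lemma linear_on_scale: "linear_on sc V f \<Longrightarrow> v \<in> V \<Longrightarrow> f (scale c v) = sc c (f v)"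
  by (simp add: linear_on_def)

lemma linear_on_zero:
  assumes "linear_on sc (free_on A) f"
  shows "f 0 = 0"
proof -
  have zero: "0 \<in> free_on A"
    by (simp add: free_on_def)
  have "f (0 + 0) = f 0 + f 0"
    by (rule linear_on_add[OF assms zero zero])
  then show ?thesis by simp
qed

text \<open>
  Every vector is a finite combination of generators, so two linear maps agreeing on generators
  agree. The scalar action \<open>sc\<close> on the target is arbitrary: scalar-valued and module-valued maps
  are then covered at once.
\<close>

lemma linear_on_eqI:
  assumes f: "linear_on sc (free_on A) f" and g: "linear_on sc (free_on A) g"
    and eq: "\<And>x. x \<in> A \<Longrightarrow> f (gen x) = g (gen x)" and v: "v \<in> free_on A"
  shows "f v = g v"
proof -
  let ?s = "\<lambda>x. scale (Poly_Mapping.lookup v x) (gen x)"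
  have "f (\<Sum>x\<in>K. ?s x) = g (\<Sum>x\<in>K. ?s x)" if "finite K" "K \<subseteq> A" for K
    using that
  proof (induction K rule: finite_induct)
    case empty
    then show ?case using linear_on_zero[OF f] linear_on_zero[OF g] by simp
  next
    case (insert x K)
    have x: "gen x \<in> free_on A" "?s x \<in> free_on A"
      using insert.prems by (auto intro: gen_in_free_on scale_in_free_on)
    have K: "(\<Sum>x\<in>K. ?s x) \<in> free_on A"
      using insert.prems by (auto intro!: sum_in_free_on scale_in_free_on gen_in_free_on)
    have "f (?s x) = g (?s x)"
      using eq[of x] insert.prems
      by (simp add: linear_on_scale[OF f x(1)] linear_on_scale[OF g x(1)])
    moreover have "f (\<Sum>x\<in>K. ?s x) = g (\<Sum>x\<in>K. ?s x)"
      using insert by simp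
    ultimately show ?case
      using insert.hyps by (simp add: linear_on_add[OF f x(2) K] linear_on_add[OF g x(2) K])
  qed
  from this[of "Poly_Mapping.keys v"] show ?thesis
    using v free_on_expansion[of v] by (simp add: lin_ext_def free_on_def)
qed

lemma scale_scale [simp]: "scale a (scale b v) = scale (a * b) v"
  by (rule poly_mapping_eqI) (simp add: mult.assoc)

lemma scale_one [simp]: "scale 1 v = v"
  by (rule poly_mapping_eqI) simp

lemma tensor_scale_left [simp]: "tensor (scale c u) v = scale c (tensor u v)"
  by (simp add: tensor_def)

lemma tensor_gen_scale [simp]: "tensor (gen x) (scale c v) = scale c (tensor (gen x) v)"
  by (simp add: tensor_def)

lemma counit_gen [simp]: "counit (gen x) = 1"
  by (simp add: counit_def gen_def)

lemma transport_gen [simp]: "transport tr I \<sigma> (gen z) = gen (tr I \<sigma> z)"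
  by (simp add: transport_def)

text \<open>
  The maps compared in the coalgebra axioms are built by nesting linear extensions. Used as an
  introduction rule, this peels off the outermost one, so that linearity of the composite is proved
  from the outside in.
\<close>

lemmas linear_on_lin_ext_compose = linear_on_compose[OF _ linear_on_lin_ext[of UNIV], simplified]

lemma linear_on_id: "linear_on scale V (\<lambda>v. v)"
  by (simp add: linear_on_def)

section \<open>The exponential of a cocycle\<close>

definition exp_coeff ::
  "('l set \<Rightarrow> 'l set \<Rightarrow> ('x \<Rightarrow>\<^sub>0 'k) \<Rightarrow> 'k) \<Rightarrow>
   nat \<Rightarrow> 'l set \<Rightarrow> 'l set \<Rightarrow> ('x \<Rightarrow>\<^sub>0 'k::field_char_0) \<Rightarrow> 'k" where
  "exp_coeff \<alpha> i S T = lin_form (\<lambda>z. \<alpha> S T (gen z) ^ i / fact i)"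

definition exp_coproduct ::
  "('l set \<Rightarrow> 'l set \<Rightarrow> 'x \<Rightarrow> 'x) \<Rightarrow> ('l set \<Rightarrow> 'l set \<Rightarrow> 'x \<Rightarrow> 'x) \<Rightarrow>
   ('l set \<Rightarrow> 'l set \<Rightarrow> ('x \<Rightarrow>\<^sub>0 'k::field_char_0) \<Rightarrow> 'k) \<Rightarrow>
   'l set \<Rightarrow> 'l set \<Rightarrow> ('x \<Rightarrow>\<^sub>0 'k fps) \<Rightarrow> ('x \<times> 'x \<Rightarrow>\<^sub>0 'k fps)" where
  "exp_coproduct lft rgt \<alpha> S T =
     lin_ext (\<lambda>z. scale (fps_exp (\<alpha> S T (gen z))) (gen (lft S T z, rgt S T z)))"

lemma exp_coproduct_gen [simp]:
  "exp_coproduct lft rgt \<alpha> S T (gen z) =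
     scale (fps_exp (\<alpha> S T (gen z))) (gen (lft S T z, rgt S T z))"
  by (simp add: exp_coproduct_def)

lemma linear_on_exp_coproduct: "linear_on scale V (exp_coproduct lft rgt \<alpha> S T)"
  by (simp add: exp_coproduct_def linear_on_lin_ext)

lemma species_map_E2_gen_natural:
  assumes "species_map_E2 X0 tr \<alpha>" "decomp S T" "inj_on \<sigma> (S \<union> T)" "z \<in> X0 (S \<union> T)"
  shows "\<alpha> (\<sigma> ` S) (\<sigma> ` T) (gen (tr (S \<union> T) \<sigma> z)) = \<alpha> S T (gen z)"
  using assms gen_in_free_on[of z "X0 (S \<union> T)"] unfolding species_map_E2_def
  by (metis transport_gen)

lemma species_map_E2_exp_coeff:
  fixes tr :: "'l set \<Rightarrow> ('l \<Rightarrow> 'l) \<Rightarrow> 'x \<Rightarrow> 'x"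
    and \<alpha> :: "'l set \<Rightarrow> 'l set \<Rightarrow> ('x \<Rightarrow>\<^sub>0 'k::field_char_0) \<Rightarrow> 'k"
  assumes "species_map_E2 X0 tr \<alpha>"
  shows "species_map_E2 X0 tr (exp_coeff \<alpha> i)"
  unfolding species_map_E2_def
proof (intro conjI allI impI ballI)
  fix S T :: "'l set"
  show "linear_on (*) (free_on (X0 (S \<union> T))) (exp_coeff \<alpha> i S T)"
    by (simp add: exp_coeff_def linear_on_lin_form)
  fix \<sigma> :: "'l \<Rightarrow> 'l" and v :: "'x \<Rightarrow>\<^sub>0 'k"
  assume *: "decomp S T" "inj_on \<sigma> (S \<union> T)" "v \<in> free_on (X0 (S \<union> T))"
  show "exp_coeff \<alpha> i (\<sigma> ` S) (\<sigma> ` T) (transport tr (S \<union> T) \<sigma> v) = exp_coeff \<alpha> i S T v"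
  proof (rule linear_on_eqI[OF _ _ _ *(3)])
    show "linear_on (*) (free_on (X0 (S \<union> T)))
        (\<lambda>v. exp_coeff \<alpha> i (\<sigma> ` S) (\<sigma> ` T) (transport tr (S \<union> T) \<sigma> v))"
      unfolding exp_coeff_def transport_def
      by (rule linear_on_compose[OF linear_on_lin_ext linear_on_lin_form UNIV_I])
    show "linear_on (*) (free_on (X0 (S \<union> T))) (exp_coeff \<alpha> i S T)"
      by (simp add: exp_coeff_def linear_on_lin_form)
  qed (use species_map_E2_gen_natural[OF assms *(1,2)] in \<open>simp add: exp_coeff_def\<close>)
qed

text \<open>
  By definition \<open>exp_coeff \<alpha> 1\<close> sees \<open>\<alpha>\<close> only on generators; linearity of \<open>\<alpha>\<close> recovers all other
  values.
\<close>

lemma exp_coeff_1: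
  assumes "species_map_E2 X0 tr \<alpha>" "decomp S T" "v \<in> free_on (X0 (S \<union> T))"
  shows "exp_coeff \<alpha> 1 S T v = \<alpha> S T v"
proof (rule linear_on_eqI[OF _ _ _ assms(3)])
  show "linear_on (*) (free_on (X0 (S \<union> T))) (exp_coeff \<alpha> 1 S T)"
    by (simp add: exp_coeff_def linear_on_lin_form)
  show "linear_on (*) (free_on (X0 (S \<union> T))) (\<alpha> S T)"
    using assms by (simp add: species_map_E2_def)
qed (simp add: exp_coeff_def)

section \<open>The deformed coalgebra\<close>

context linearized_coalgebra
begin

lemma exp_coproduct_closed:
  assumes "decomp S T" "v \<in> free_on (X0 (S \<union> T))"
  shows "exp_coproduct lft rgt \<alpha> S T v \<in> free_on (X0 S \<times> X0 T)"
  unfolding exp_coproduct_def using assms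
  by (auto intro!: lin_ext_in_free_on[OF assms(2)] scale_in_free_on gen_in_free_on
      lft_closed rgt_closed)

lemma exp_coproduct_natural:
  assumes \<alpha>: "species_map_E2 X0 tr \<alpha>"
    and *: "decomp S T" "inj_on \<sigma> (S \<union> T)" "v \<in> free_on (X0 (S \<union> T))"
  shows "exp_coproduct lft rgt \<alpha> (\<sigma> ` S) (\<sigma> ` T) (transport tr (S \<union> T) \<sigma> v) =
    tensor_map (transport tr S \<sigma>) (transport tr T \<sigma>) (exp_coproduct lft rgt \<alpha> S T v)"
proof (rule linear_on_eqI[where sc = scale, OF _ _ _ *(3)])
  show "linear_on scale (free_on (X0 (S \<union> T)))
      (\<lambda>v. exp_coproduct lft rgt \<alpha> (\<sigma> ` S) (\<sigma> ` T) (transport tr (S \<union> T) \<sigma> v))"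
    unfolding exp_coproduct_def transport_def
    by (intro linear_on_lin_ext_compose linear_on_lin_ext)
  show "linear_on scale (free_on (X0 (S \<union> T)))
      (\<lambda>v. tensor_map (transport tr S \<sigma>) (transport tr T \<sigma>) (exp_coproduct lft rgt \<alpha> S T v))"
    unfolding tensor_map_def
    by (intro linear_on_lin_ext_compose linear_on_exp_coproduct)
qed (simp add: tensor_map_def lft_natural rgt_natural * species_map_E2_gen_natural[OF \<alpha> *(1,2)])

text \<open>
  On a generator both sides are scalar multiples of the same threefold tensor, and the scalars are
  the exponentials of the two sides of the cocycle identity.
\<close>

lemma exp_coproduct_coassoc:
  assumes \<alpha>: "two_cocycle X0 tr lft rgt \<alpha>"
    and *: "decomp3 R S T" "v \<in> free_on (X0 (R \<union> S \<union> T))"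
  shows "reassoc (tensor_map (exp_coproduct lft rgt \<alpha> R S) id
      (exp_coproduct lft rgt \<alpha> (R \<union> S) T v)) =
    tensor_map id (exp_coproduct lft rgt \<alpha> S T) (exp_coproduct lft rgt \<alpha> R (S \<union> T) v)"
proof (rule linear_on_eqI[where sc = scale, OF _ _ _ *(2)])
  show "linear_on scale (free_on (X0 (R \<union> S \<union> T)))
      (\<lambda>v. reassoc (tensor_map (exp_coproduct lft rgt \<alpha> R S) id
        (exp_coproduct lft rgt \<alpha> (R \<union> S) T v)))"
    unfolding tensor_map_def reassoc_def
    by (intro linear_on_lin_ext_compose linear_on_exp_coproduct)
  show "linear_on scale (free_on (X0 (R \<union> S \<union> T)))
      (\<lambda>v. tensor_map id (exp_coproduct lft rgt \<alpha> S T) (exp_coproduct lft rgt \<alpha> R (S \<union> T) v))"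
    unfolding tensor_map_def
    by (intro linear_on_lin_ext_compose linear_on_exp_coproduct)
next
  fix z assume z: "z \<in> X0 (R \<union> S \<union> T)"
  have "\<alpha> (R \<union> S) T (gen z) + \<alpha> R S (gen (lft (R \<union> S) T z)) =
      \<alpha> R (S \<union> T) (gen z) + \<alpha> S T (gen (rgt R (S \<union> T) z))"
    using \<alpha> *(1) z by (simp add: two_cocycle_def)
  then have "fps_exp (\<alpha> (R \<union> S) T (gen z)) * fps_exp (\<alpha> R S (gen (lft (R \<union> S) T z))) =
      fps_exp (\<alpha> R (S \<union> T) (gen z)) * fps_exp (\<alpha> S T (gen (rgt R (S \<union> T) z)))"
    by (simp flip: fps_exp_add_mult)
  then show "reassoc (tensor_map (exp_coproduct lft rgt \<alpha> R S) id
      (exp_coproduct lft rgt \<alpha> (R \<union> S) T (gen z))) =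
    tensor_map id (exp_coproduct lft rgt \<alpha> S T) (exp_coproduct lft rgt \<alpha> R (S \<union> T) (gen z))"
    using coassoc_left[OF *(1) z] coassoc_middle[OF *(1) z] coassoc_right[OF *(1) z]
    by (simp add: tensor_map_def reassoc_def)
qed

text \<open>
  Normalization turns the scalar factor into \<open>exp 0 = 1\<close>, which leaves the counit axioms of the
  undeformed coalgebra.
\<close>

lemma exp_coproduct_counit:
  assumes \<alpha>: "normalized X0 \<alpha>" and *: "finite I" "v \<in> free_on (X0 I)"
  shows "lin_ext (\<lambda>(x, y). scale (counit (gen x)) (gen y)) (exp_coproduct lft rgt \<alpha> {} I v) = v"
    and "lin_ext (\<lambda>(x, y). scale (counit (gen y)) (gen x)) (exp_coproduct lft rgt \<alpha> I {} v) = v"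
proof -
  have zero: "\<alpha> {} I (gen z) = 0" "\<alpha> I {} (gen z) = 0" if "z \<in> X0 I" for z
    using \<alpha> *(1) that gen_in_free_on[of z "X0 I"] unfolding normalized_def decomp_def by force+
  show "lin_ext (\<lambda>(x, y). scale (counit (gen x)) (gen y)) (exp_coproduct lft rgt \<alpha> {} I v) = v"
    by (rule linear_on_eqI[where sc = scale, OF _ linear_on_id _ *(2)])
      (simp_all add: zero counit_left * linear_on_lin_ext_compose linear_on_exp_coproduct)
  show "lin_ext (\<lambda>(x, y). scale (counit (gen y)) (gen x)) (exp_coproduct lft rgt \<alpha> I {} v) = v"
    by (rule linear_on_eqI[where sc = scale, OF _ linear_on_id _ *(2)])
      (simp_all add: zero counit_right * linear_on_lin_ext_compose linear_on_exp_coproduct)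
qed

lemma coalgebra_exp_coproduct:
  assumes "two_cocycle X0 tr lft rgt \<alpha>" "normalized X0 \<alpha>"
  shows "coalgebra X0 tr (exp_coproduct lft rgt \<alpha>)"
proof -
  have "species_map_E2 X0 tr \<alpha>"
    using assms(1) by (simp add: two_cocycle_def)
  then show ?thesis
    unfolding coalgebra_def
    by (intro conjI allI impI ballI linear_on_exp_coproduct exp_coproduct_closed
        exp_coproduct_natural exp_coproduct_coassoc[OF assms(1)] exp_coproduct_counit[OF assms(2)])
qed

lemma weak_deformation_exp:
  assumes "two_cocycle X0 tr lft rgt \<alpha>" "normalized X0 \<alpha>"
  shows "weak_deformation X0 tr lft rgt (exp_coproduct lft rgt \<alpha>) (exp_coeff \<alpha>)"
proof -
  have "species_map_E2 X0 tr \<alpha>"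
    using assms(1) by (simp add: two_cocycle_def)
  then show ?thesis
    unfolding weak_deformation_def
    using coalgebra_exp_coproduct[OF assms] species_map_E2_exp_coeff
    by (auto simp: exp_coeff_def fps_exp_def)
qed

end

theorem theorem5p1:
  fixes X0 :: "'l::infinite set \<Rightarrow> 'x set"
    and tr :: "'l set \<Rightarrow> ('l \<Rightarrow> 'l) \<Rightarrow> 'x \<Rightarrow> 'x"
    and lft rgt :: "'l set \<Rightarrow> 'l set \<Rightarrow> 'x \<Rightarrow> 'x"
    and \<Delta>1 :: "'l set \<Rightarrow> 'l set \<Rightarrow> ('x \<Rightarrow>\<^sub>0 'k::field_char_0) \<Rightarrow> 'k"
  assumes "linearized_coalgebra X0 tr lft rgt"
    and "two_cocycle X0 tr lft rgt \<Delta>1"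
    and "normalized X0 \<Delta>1"
  shows "\<exists>\<Delta>t D. weak_deformation X0 tr lft rgt \<Delta>t D \<and>
           (\<forall>S T. decomp S T \<longrightarrow> (\<forall>v\<in>free_on (X0 (S \<union> T)). D 1 S T v = \<Delta>1 S T v))"
  using linearized_coalgebra.weak_deformation_exp[OF assms] exp_coeff_1 assms(2)
  unfolding two_cocycle_def by blast

end
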